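(* The equation $\mathcal E[\Phi]=0$ has exactly two solution germs $\Phi_1,\Phi_2$ that are analytic at $z=0$ and normalized by $\Phi(0)=1$. They are characterized by $$\Phi_1'(0)=\frac15,\qquad \Phi_2'(0)=\frac16 .$$ Once one of these values of $\Phi'(0)$ is chosen, all subsequent Taylor coefficients of the solution are uniquely determined.
   Context: For a function $\Phi$ of $z$, let $\theta=z\,\frac{d}{dz}$ and put $$A=(4+7\theta)\Phi,\qquad B=(3+7\theta)A,\qquad C=(2+7\theta)B.$$ The nonlinear third-order differential expression $\mathcal E$ is \begin{align*} \mathcal E[\Phi]={}&240+8C-72B+3B^2+48A-2AC\\ &+z\bigl[-512B+192AB+384A^2-48A^2B-48A^3+4A^3B\\ &\qquad+192\Phi B-768\Phi A+48\Phi A^2+240\Phi^2-24\Phi^2B+12\Phi^2A\bigr]\\ &+z^2\bigl[512A^3-192A^4+24A^5-A^6-1536\Phi A^2+384\Phi A^3-24\Phi A^4\\ &\qquad+1536\Phi^2A-192\Phi^2A^2-512\Phi^3-32\Phi^3A+4\Phi^3A^2+36\Phi^4\bigr]. \end{align*} A germ analytic at $z=0$ is a power series in $z$ with positive radius of convergence. *)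

theory Defs
  imports "HOL-Analysis.Analysis"
begin

definition theta :: "complex fps \<Rightarrow> complex fps" where
  "theta F = fps_X * fps_deriv F"

definition A_of :: "complex fps \<Rightarrow> complex fps" where
  "A_of \<Phi> = 4 * \<Phi> + 7 * theta \<Phi>"

definition B_of :: "complex fps \<Rightarrow> complex fps" where
  "B_of \<Phi> = 3 * A_of \<Phi> + 7 * theta (A_of \<Phi>)"

definition C_of :: "complex fps \<Rightarrow> complex fps" where
  "C_of \<Phi> = 2 * B_of \<Phi> + 7 * theta (B_of \<Phi>)"

definition diffexpr :: "complex fps \<Rightarrow> complex fps" where
  "diffexpr \<Phi> =
    (let A = A_of \<Phi>; B = B_of \<Phi>; C = C_of \<Phi>; z = fps_X in
      240 + 8*C - 72*B + 3*B^2 + 48*A - 2*A*C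
      + z * (- 512*B + 192*A*B + 384*A^2 - 48*A^2*B - 48*A^3 + 4*A^3*B
             + 192*\<Phi>*B - 768*\<Phi>*A + 48*\<Phi>*A^2 + 240*\<Phi>^2 - 24*\<Phi>^2*B + 12*\<Phi>^2*A)
      + z^2 * (512*A^3 - 192*A^4 + 24*A^5 - A^6 - 1536*\<Phi>*A^2 + 384*\<Phi>*A^3 - 24*\<Phi>*A^4
             + 1536*\<Phi>^2*A - 192*\<Phi>^2*A^2 - 512*\<Phi>^3 - 32*\<Phi>^3*A + 4*\<Phi>^3*A^2 + 36*\<Phi>^4))"

definition normalized_formal_solution :: "complex fps \<Rightarrow> bool" where
  "normalized_formal_solution \<Phi> \<longleftrightarrow> diffexpr \<Phi> = 0 \<and> fps_nth \<Phi> 0 = 1"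

text \<open>A germ analytic at the origin is represented by its Taylor series, a power series with
  positive radius of convergence; algebraic operations and differentiation of germs are then those
  of formal power series.\<close>

definition normalized_solution_germ :: "complex fps \<Rightarrow> bool" where
  "normalized_solution_germ \<Phi> \<longleftrightarrow> normalized_formal_solution \<Phi> \<and> fps_conv_radius \<Phi> > 0"

abbreviation deriv0 :: "complex fps \<Rightarrow> complex" where
  "deriv0 \<Phi> \<equiv> fps_nth (fps_deriv \<Phi>) 0"

end

theory Submission
  imports Defs
begin

text \<open>The constant values \<open>\<Phi> = 1\<close>, \<open>A = 4\<close>, \<open>B = 12\<close>, \<open>C = 24\<close> are a degenerate point of the
  equation: there the part free of explicit factors \<open>z\<close> vanishes together with its partial derivatives
  in \<open>A\<close>, \<open>B\<close>, \<open>C\<close>, and the bracket multiplied by \<open>z\<close> vanishes as well. Hence with \<open>\<Phi> = 1 + z u\<close> the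
  expression starts at \<open>z\<^sup>2\<close>, with a coefficient that is quadratic in \<open>q = u(0)\<close>, namely
  \<open>484 (1 - 5 q) (1 - 6 q)\<close>. This forces \<open>\<Phi>'(0) \<in> {1/5, 1/6}\<close>.

  For such a \<open>q\<close>, write \<open>\<Phi> = 1 + q z + z\<^sup>2 v\<close>. The expression becomes \<open>z\<^sup>3 (L v + H v)\<close>
  (\<open>diffexpr_jet_ansatz\<close>). Here \<open>L\<close> is an Euler operator: it multiplies the \<open>n\<close>-th coefficient by a
  cubic polynomial in \<open>n\<close>, \<open>indicial q n\<close>. In \<open>H\<close>, the series \<open>v\<close> and its derivatives occur only
  with at least one factor \<open>z\<close>, so that the \<open>n\<close>-th coefficient of \<open>H v\<close> depends only on the
  coefficients of \<open>v\<close> below \<open>n\<close>. The cubic factors into linear factors with no root at an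
  integer \<open>n \<ge> 0\<close> (\<open>indicial_one_fifth\<close>, \<open>indicial_one_sixth\<close>), so the equation is a recursion that
  determines \<open>v\<close> uniquely (\<open>causal_fixpoint\<close>).

  The solution converges because the cubic dominates the factor by which the third-order
  Euler operator in \<open>C\<close> acts on the \<open>n\<close>-th coefficient (\<open>indicial_lower_bound\<close>). Solving the
  recursion therefore loses no derivative. With the seminorms \<open>\<Sum>n<N. |f\<^sub>n| r\<^sup>n\<close>, which are
  submultiplicative and shrink by the factor \<open>r\<close> under multiplication by \<open>z\<close>, a bound on the
  third-order term passes from \<open>N\<close> to \<open>N + 1\<close> once \<open>r\<close> is small
  (\<open>recursion_fixpoint_psum_norm_bounded\<close>).\<close>

section \<open>Causal operators on power series\<close>

definition agree :: "nat \<Rightarrow> 'a fps \<Rightarrow> 'a fps \<Rightarrow> bool" where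
  "agree n f g \<longleftrightarrow> (\<forall>k<n. fps_nth f k = fps_nth g k)"

lemma agree_refl [simp]: "agree n f f"
  by (simp add: agree_def)

lemma agree_sym: "agree n f g \<Longrightarrow> agree n g f"
  by (simp add: agree_def)

lemma agree_trans: "agree n f g \<Longrightarrow> agree n g h \<Longrightarrow> agree n f h"
  by (simp add: agree_def)

lemma agree_all_imp_eq: "(\<And>n. agree n f g) \<Longrightarrow> f = g"
  by (auto simp: agree_def fps_eq_iff)

lemma agree_add: "agree n f g \<Longrightarrow> agree n f' g' \<Longrightarrow> agree n (f + f') (g + g')"
  for f :: "'a::monoid_add fps"
  by (simp add: agree_def)

lemma agree_diff: "agree n f g \<Longrightarrow> agree n f' g' \<Longrightarrow> agree n (f - f') (g - g')"
  for f :: "'a::group_add fps"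
  by (simp add: agree_def)

lemma agree_mult: "agree n f g \<Longrightarrow> agree n f' g' \<Longrightarrow> agree n (f * f') (g * g')"
  for f :: "'a::semiring_0 fps"
  by (auto simp: agree_def fps_mult_nth intro!: sum.cong)

lemma agree_power: "agree n f g \<Longrightarrow> agree n (f ^ k) (g ^ k)"
  for f :: "'a::semiring_1 fps"
  by (induction k) (auto intro: agree_mult)

lemma agree_X_mult: "agree n f g \<Longrightarrow> agree (Suc n) (fps_X * f) (fps_X * g)"
  for f :: "'a::semiring_1 fps"
  by (auto simp: agree_def)

text \<open>An operator that gains one coefficient of agreement is a contraction for the \<open>z\<close>-adic metric.
  The fixed point is read off diagonally from the iterates that start at \<open>0\<close>.\<close>

lemma causal_fixpoint:
  fixes T :: "'a::zero fps \<Rightarrow> 'a fps"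
  assumes causal: "\<And>n f g. agree n f g \<Longrightarrow> agree (Suc n) (T f) (T g)"
  shows "\<exists>!f. T f = f"
proof (rule ex_ex1I)
  have iter: "agree n ((T ^^ n) 0) ((T ^^ (n + m)) 0)" for n m
    by (induction n) (auto simp: agree_def[of 0] intro: causal)
  define f where "f = Abs_fps (\<lambda>n. fps_nth ((T ^^ Suc n) 0) n)"
  have f: "agree n f ((T ^^ n) 0)" for n
    unfolding agree_def
  proof (intro allI impI)
    fix k assume "k < n"
    then have "n = Suc k + (n - Suc k)" by simp
    with iter[of "Suc k" "n - Suc k"] show "fps_nth f k = fps_nth ((T ^^ n) 0) k"
      by (simp add: f_def agree_def)
  qed
  have "agree n (T f) f" for n
  proof -
    have "agree (Suc n) (T f) ((T ^^ Suc n) 0)"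
      using causal[OF f[of n]] by simp
    then have "agree (Suc n) (T f) f"
      using f[of "Suc n"] by (blast intro: agree_sym agree_trans)
    then show ?thesis by (simp add: agree_def)
  qed
  then show "\<exists>f. T f = f" by (blast intro: agree_all_imp_eq)
next
  fix f g assume fg: "T f = f" "T g = g"
  have "agree n f g" for n
    using fg by (induction n) (auto simp: agree_def[of 0] dest: causal)
  then show "f = g" by (rule agree_all_imp_eq)
qed

section \<open>Weighted partial sums of the coefficients\<close>

text \<open>Cutting the sum off at \<open>N\<close> makes it finite for every formal power series, so that
  uniform bounds can be proved by induction on \<open>N\<close> before convergence is known.\<close>

definition psum_norm :: "real \<Rightarrow> nat \<Rightarrow> 'a::real_normed_vector fps \<Rightarrow> real" where
  "psum_norm r N f = (\<Sum>n<N. norm (fps_nth f n) * r ^ n)"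

lemma psum_norm_nonneg: "0 \<le> r \<Longrightarrow> 0 \<le> psum_norm r N f"
  by (simp add: psum_norm_def sum_nonneg)

lemma psum_norm_mono:
  assumes "0 \<le> r" and "\<And>n. norm (fps_nth f n) \<le> norm (fps_nth g n)"
  shows "psum_norm r N f \<le> psum_norm r N g"
  unfolding psum_norm_def using assms by (intro sum_mono mult_right_mono) auto

lemma psum_norm_0 [simp]: "psum_norm r 0 f = 0"
  by (simp add: psum_norm_def)

text \<open>A factor \<open>z\<close> costs one step in \<open>N\<close> and yields the small factor \<open>r\<close>. Both effects are needed to
  close the induction for the recursion.\<close>

lemma psum_norm_X_mult: "psum_norm r (Suc N) (fps_X * f) = r * psum_norm r N f"
  for f :: "'a::real_normed_algebra_1 fps"
proof -
  have "psum_norm r (Suc N) (fps_X * f) = (\<Sum>n<N. norm (fps_nth f n) * r ^ Suc n)"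
    unfolding psum_norm_def by (subst sum.lessThan_Suc_shift) simp
  then show ?thesis by (simp add: psum_norm_def sum_distrib_left mult_ac)
qed

lemma psum_norm_const_le:
  assumes "0 \<le> r"
  shows "psum_norm r N (fps_const x) \<le> norm x"
proof (cases N)
  case (Suc M)
  then show ?thesis
    unfolding psum_norm_def by (simp only: sum.lessThan_Suc_shift) simp
qed simp

lemma psum_norm_numeral_le: "0 \<le> r \<Longrightarrow> psum_norm r N (numeral k :: 'a::real_normed_algebra_1 fps) \<le> numeral k"
  using psum_norm_const_le[of r N "numeral k :: 'a"] by (simp add: numeral_fps_const)

lemma psum_norm_X_le: "0 \<le> r \<Longrightarrow> psum_norm r N (fps_X :: 'a::real_normed_algebra_1 fps) \<le> r"
proof (cases N)
  case (Suc M)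
  assume "0 \<le> r"
  then have "psum_norm r M (fps_const (1::'a)) \<le> 1"
    using psum_norm_const_le[of r M "1::'a"] by simp
  with \<open>0 \<le> r\<close> show ?thesis
    using psum_norm_X_mult[of r M "1 :: 'a fps"] Suc mult_left_mono[of _ 1 r] by simp
qed simp

text \<open>The rules below carry the bounds of the operands as variables, so that a bound for a polynomial
  expression follows by resolution along its term structure.\<close>

lemma psum_norm_add_le:
  assumes "0 \<le> r" "psum_norm r N f \<le> A" "psum_norm r N g \<le> B"
  shows "psum_norm r N (f + g) \<le> A + B"
proof -
  have "psum_norm r N (f + g) \<le> psum_norm r N f + psum_norm r N g"
    unfolding psum_norm_def sum.distrib[symmetric] distrib_right[symmetric]
    using assms(1) by (intro sum_mono mult_right_mono) (auto intro: norm_triangle_ineq)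
  with assms show ?thesis by simp
qed

lemma psum_norm_diff_le:
  assumes "0 \<le> r" "psum_norm r N f \<le> A" "psum_norm r N g \<le> B"
  shows "psum_norm r N (f - g) \<le> A + B"
  using psum_norm_add_le[of r N f A "- g" B] assms by (simp add: psum_norm_def)

lemma psum_norm_mult_le:
  fixes f g :: "'a::real_normed_algebra fps"
  assumes "0 \<le> r" "psum_norm r N f \<le> A" "psum_norm r N g \<le> B"
  shows "psum_norm r N (f * g) \<le> A * B"
proof -
  define F where "F i = norm (fps_nth f i) * r ^ i" for i
  define G where "G i = norm (fps_nth g i) * r ^ i" for i
  have F: "0 \<le> F i" and G: "0 \<le> G i" for i
    using assms(1) by (simp_all add: F_def G_def)
  \<comment> \<open>The Cauchy product below order \<open>N\<close> sums over a triangle inside the square \<open>{..<N} \<times> {..<N}\<close>.\<close>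
  have "psum_norm r N (f * g) \<le> (\<Sum>n<N. \<Sum>i\<le>n. F i * G (n - i))"
    unfolding psum_norm_def
  proof (rule sum_mono)
    fix n
    have "norm (fps_nth (f * g) n) * r ^ n
        \<le> (\<Sum>i\<le>n. norm (fps_nth f i) * norm (fps_nth g (n - i))) * r ^ n"
      unfolding fps_mult_nth atLeast0AtMost using assms(1)
      by (intro mult_right_mono sum_norm_le norm_mult_ineq) auto
    also have "\<dots> = (\<Sum>i\<le>n. F i * G (n - i))"
      unfolding sum_distrib_right
    proof (rule sum.cong)
      fix i assume "i \<in> {..n}"
      then have "r ^ n = r ^ i * r ^ (n - i)" by (simp flip: power_add)
      then show "norm (fps_nth f i) * norm (fps_nth g (n - i)) * r ^ n = F i * G (n - i)"
        by (simp add: F_def G_def)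
    qed simp
    finally show "norm (fps_nth (f * g) n) * r ^ n \<le> (\<Sum>i\<le>n. F i * G (n - i))" .
  qed
  also have "\<dots> = (\<Sum>(i, j)\<in>{(i, j). i + j < N}. F i * G j)"
    by (rule sum.triangle_reindex[symmetric])
  also have "\<dots> \<le> (\<Sum>(i, j)\<in>{..<N} \<times> {..<N}. F i * G j)"
    using F G by (intro sum_mono2) auto
  also have "\<dots> = psum_norm r N f * psum_norm r N g"
    by (simp add: psum_norm_def F_def G_def sum_product sum.cartesian_product)
  also have "\<dots> \<le> A * B"
    using assms by (intro mult_mono psum_norm_nonneg order_trans[OF psum_norm_nonneg assms(2)])
  finally show ?thesis .
qed

lemma psum_norm_power_le:
  fixes f :: "'a::real_normed_algebra_1 fps"
  assumes "0 \<le> r" "psum_norm r N f \<le> A"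
  shows "psum_norm r N (f ^ k) \<le> A ^ k"
proof (induction k)
  case 0
  show ?case using psum_norm_const_le[of r N "1::'a"] assms(1) by simp
next
  case (Suc k)
  show ?case using psum_norm_mult_le[OF assms Suc] by simp
qed

lemma fps_conv_radius_ge_if_psum_norm_bounded:
  fixes f :: "complex fps"
  assumes "0 < r" and bounded: "\<And>N. psum_norm r N f \<le> M"
  shows "fps_conv_radius f \<ge> ereal r"
proof -
  have "summable (\<lambda>n. norm (fps_nth f n) * r ^ n)"
    using assms by (intro summableI_nonneg_bounded[where x = M]) (auto simp: psum_norm_def)
  then have "summable (\<lambda>n. fps_nth f n * of_real r ^ n)"
    using \<open>0 < r\<close> by - (rule summable_norm_cancel, simp add: norm_mult norm_power)
  then have "conv_radius (fps_nth f) \<ge> norm (complex_of_real r)"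
    by (rule conv_radius_geI)
  with \<open>0 < r\<close> show ?thesis by (simp add: fps_conv_radius_def)
qed

section \<open>Reduction to an equation with dominant linear part\<close>

text \<open>The operators \<open>k + 7 \<theta>\<close>, from which \<open>A\<close>, \<open>B\<close> and \<open>C\<close> are composed.\<close>

definition euler :: "nat \<Rightarrow> complex fps \<Rightarrow> complex fps" where
  "euler k f = of_nat k * f + 7 * theta f"

lemma fps_nth_euler: "fps_nth (euler k f) n = of_nat (k + 7 * n) * fps_nth f n"
proof -
  have "fps_nth (theta f) n = of_nat n * fps_nth f n"
    by (cases n) (simp_all add: theta_def)
  then show ?thesis
    by (simp add: euler_def numeral_fps_const fps_of_nat[symmetric] algebra_simps)
qed

lemma euler_add: "euler k (f + g) = euler k f + euler k g"
  by (simp add: fps_eq_iff fps_nth_euler algebra_simps)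

lemma euler_const: "euler k (fps_const x) = fps_const (of_nat k * x)"
  by (simp add: fps_eq_iff fps_nth_euler)

lemma euler_X_mult: "euler k (fps_X * f) = fps_X * euler (k + 7) f"
proof (rule fps_ext)
  fix n show "fps_nth (euler k (fps_X * f)) n = fps_nth (fps_X * euler (k + 7) f) n"
    by (cases n) (simp_all add: fps_nth_euler algebra_simps)
qed

lemma A_of_eq_euler: "A_of f = euler 4 f"
  and B_of_eq_euler: "B_of f = euler 3 (A_of f)"
  and C_of_eq_euler: "C_of f = euler 2 (B_of f)"
  by (simp_all add: A_of_def B_of_def C_of_def euler_def)

text \<open>What remains of \<open>diffexpr (1 + z u) / z\<^sup>2\<close> above its leading part when \<open>A = 4 + z a\<close> and \<open>B = 12 + z b\<close>;
  one factor \<open>z\<close> has been divided out.\<close>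

definition higher_part :: "'a::comm_ring_1 \<Rightarrow> 'a \<Rightarrow> 'a \<Rightarrow> 'a \<Rightarrow> 'a" where
  "higher_part z u a b =
     144*u*b - 144*a^2 - 1584*u - 360*u*a
     + z * (48*u*a^2 - 188*a^2 + 1560*u^2 - 24*u^2*b + 12*u^2*a)
     + z^2 * (4*a^3*b + 396*u*a^2 - 432*u^3)
     + z^3 * (24*a^4 - 180*u^2*a^2 + 36*u^4)
     + z^4 * (4*u^3*a^2 - 24*u*a^4)
     - z^5 * a^6"

definition jet_ansatz :: "complex \<Rightarrow> complex fps \<Rightarrow> complex fps" where
  "jet_ansatz q v = 1 + fps_X * (fps_const q + fps_X * v)"

text \<open>Commuting \<open>z\<^sup>2\<close> past \<open>k + 7 \<theta>\<close> raises \<open>k\<close> by \<open>14\<close>, so the indices \<open>4\<close>, \<open>3\<close>, \<open>2\<close> in \<open>A\<close>, \<open>B\<close>, \<open>C\<close>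
  become \<open>18\<close>, \<open>17\<close>, \<open>16\<close> for the contributions of \<open>v\<close>.\<close>

definition alpha :: "complex fps \<Rightarrow> complex fps" where "alpha v = euler 18 v"
definition beta :: "complex fps \<Rightarrow> complex fps" where "beta v = euler 17 (alpha v)"
definition gamma :: "complex fps \<Rightarrow> complex fps" where "gamma v = euler 16 (beta v)"

text \<open>The constants \<open>11 q\<close> and \<open>110 q\<close> are the first-order coefficients of \<open>A\<close> and \<open>B\<close>: \<open>k + 7 \<theta>\<close>
  multiplies the coefficient of \<open>z\<close> by \<open>k + 7\<close>.\<close>

definition nonlinear_part :: "complex \<Rightarrow> complex fps \<Rightarrow> complex fps" where
  "nonlinear_part q v =
     fps_X * (3 * beta v ^ 2 - 2 * alpha v * gamma v)
     + higher_part fps_X (fps_const q + fps_X * v)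
         (fps_const (11 * q) + fps_X * alpha v) (fps_const (110 * q) + fps_X * beta v)"

definition linear_part :: "complex \<Rightarrow> complex fps \<Rightarrow> complex fps" where
  "linear_part q v = fps_const (660 * q - 88) * beta v + fps_const (396 - 1980 * q) * alpha v
     - fps_const (22 * q) * gamma v"

definition indicial :: "complex \<Rightarrow> nat \<Rightarrow> complex" where
  "indicial q n = of_nat (18 + 7 * n) * (396 - 1980 * q + of_nat (17 + 7 * n) *
     (660 * q - 88 - 22 * q * of_nat (16 + 7 * n)))"

lemma jet_ansatz_A: "A_of (jet_ansatz q v)
    = 4 + fps_X * (fps_const (11 * q) + fps_X * alpha v)"
  and jet_ansatz_B: "B_of (jet_ansatz q v)
    = 12 + fps_X * (fps_const (110 * q) + fps_X * beta v)"
  and jet_ansatz_C: "C_of (jet_ansatz q v)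
    = 24 + fps_X * (fps_const (990 * q) + fps_X * gamma v)"
proof -
  have one: "1 = fps_const (1::complex)" by simp
  show A: "A_of (jet_ansatz q v) = 4 + fps_X * (fps_const (11 * q) + fps_X * alpha v)"
    unfolding A_of_eq_euler jet_ansatz_def one
    by (simp only: euler_add euler_X_mult euler_const)
      (simp add: alpha_def numeral_fps_const)
  show B: "B_of (jet_ansatz q v) = 12 + fps_X * (fps_const (110 * q) + fps_X * beta v)"
    unfolding B_of_eq_euler A numeral_fps_const
    by (simp only: euler_add euler_X_mult euler_const) (simp add: beta_def)
  show "C_of (jet_ansatz q v) = 24 + fps_X * (fps_const (990 * q) + fps_X * gamma v)"
    unfolding C_of_eq_euler B numeral_fps_const
    by (simp only: euler_add euler_X_mult euler_const) (simp add: gamma_def)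
qed

text \<open>The terms of order \<open>0\<close> and \<open>1\<close> in \<open>z\<close> cancel, and \<open>c\<close> survives only in the product
  \<open>a c\<close>. This is the degeneracy that puts
  the choice of \<open>u(0)\<close> into a quadratic equation.\<close>

lemma expand_at_constant_solution:
  fixes z u a b c :: "'a::idom"
  shows "(let \<Phi> = 1 + z*u; A = 4 + z*a; B = 12 + z*b; C = 24 + z*c in
      240 + 8*C - 72*B + 3*B^2 + 48*A - 2*A*C
      + z * (- 512*B + 192*A*B + 384*A^2 - 48*A^2*B - 48*A^3 + 4*A^3*B
             + 192*\<Phi>*B - 768*\<Phi>*A + 48*\<Phi>*A^2 + 240*\<Phi>^2 - 24*\<Phi>^2*B + 12*\<Phi>^2*A)
      + z^2 * (512*A^3 - 192*A^4 + 24*A^5 - A^6 - 1536*\<Phi>*A^2 + 384*\<Phi>*A^3 - 24*\<Phi>*A^4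
             + 1536*\<Phi>^2*A - 192*\<Phi>^2*A^2 - 512*\<Phi>^3 - 32*\<Phi>^3*A + 4*\<Phi>^3*A^2 + 36*\<Phi>^4))
    = z^2 * (484 - 88*b + 396*a + 3*b^2 - 2*a*c + z * higher_part z u a b)"
  unfolding Let_def higher_part_def by algebra

text \<open>The linear operator collects the terms \<open>- 88 b + 396 a\<close> and the cross terms of the quadratic form
  \<open>3 b\<^sup>2 - 2 a c\<close>. Its
  third-order coefficient is \<open>- 22 q\<close>, hence nonzero for the two admissible values of \<open>q\<close>.\<close>

lemma expand_at_first_order_jet:
  fixes z q a b c :: "'a::idom"
  shows "484 - 88*(110*q + z*b) + 396*(11*q + z*a) + 3*(110*q + z*b)^2
       - 2*(11*q + z*a)*(990*q + z*c)
    = 484*(1 - 5*q)*(1 - 6*q)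
      + z * ((660*q - 88)*b + (396 - 1980*q)*a - 22*q*c + z*(3*b^2 - 2*a*c))"
  by algebra

lemma diffexpr_jet_ansatz:
  "diffexpr (jet_ansatz q v) = fps_X ^ 2 * (fps_const (484 * (1 - 5*q) * (1 - 6*q))
     + fps_X * (linear_part q v + nonlinear_part q v))"
proof -
  define Q where "Q = fps_const q"
  have num: "fps_const (numeral k * q) = numeral k * Q" for k
    by (simp add: Q_def numeral_fps_const)
  have "diffexpr (jet_ansatz q v) = fps_X ^ 2 *
      (484 - 88*(110*Q + fps_X*beta v) + 396*(11*Q + fps_X*alpha v) + 3*(110*Q + fps_X*beta v)^2
       - 2*(11*Q + fps_X*alpha v)*(990*Q + fps_X*gamma v)
       + fps_X * higher_part fps_X (Q + fps_X * v) (11*Q + fps_X*alpha v) (110*Q + fps_X*beta v))"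
    unfolding diffexpr_def jet_ansatz_A jet_ansatz_B jet_ansatz_C num
    unfolding jet_ansatz_def Q_def[symmetric]
    using expand_at_constant_solution[of fps_X "Q + fps_X * v" "11*Q + fps_X*alpha v"
        "110*Q + fps_X*beta v" "990*Q + fps_X*gamma v"]
    by (simp only: Let_def)
  also have "\<dots> = fps_X ^ 2 * (484*(1 - 5*Q)*(1 - 6*Q)
      + fps_X * ((660*Q - 88)*beta v + (396 - 1980*Q)*alpha v - 22*Q*gamma v
        + nonlinear_part q v))"
    unfolding expand_at_first_order_jet nonlinear_part_def num Q_def[symmetric]
    by (simp only: distrib_left add.assoc)
  also have "484*(1 - 5*Q)*(1 - 6*Q) = fps_const (484 * (1 - 5*q) * (1 - 6*q))"
    by (simp add: Q_def numeral_fps_const flip: fps_const_1_eq_1)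
  also have "(660*Q - 88)*beta v + (396 - 1980*Q)*alpha v - 22*Q*gamma v = linear_part q v"
    by (simp add: linear_part_def Q_def numeral_fps_const)
  finally show ?thesis .
qed

lemma fps_nth_alpha: "fps_nth (alpha v) n = of_nat (18 + 7 * n) * fps_nth v n"
  by (simp add: alpha_def fps_nth_euler)

lemma fps_nth_beta: "fps_nth (beta v) n = of_nat (17 + 7 * n) * of_nat (18 + 7 * n) * fps_nth v n"
  by (simp add: beta_def fps_nth_euler fps_nth_alpha)

lemma fps_nth_gamma:
  "fps_nth (gamma v) n = of_nat (16 + 7 * n) * of_nat (17 + 7 * n) * of_nat (18 + 7 * n) * fps_nth v n"
  by (simp add: gamma_def fps_nth_euler fps_nth_beta)

lemma fps_nth_linear_part: "fps_nth (linear_part q v) n = indicial q n * fps_nth v n"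
  unfolding linear_part_def indicial_def
  by (simp only: fps_add_nth fps_sub_nth fps_mult_left_const_nth fps_nth_alpha fps_nth_beta
      fps_nth_gamma) (simp add: algebra_simps)

lemma indicial_one_fifth:
  "indicial (1/5) n = - (22/5) * (of_nat (6 + 7*n) * of_nat (17 + 7*n) * of_nat (18 + 7*n))"
  by (simp add: indicial_def field_simps)

lemma indicial_one_sixth:
  "indicial (1/6) n = - (11/3) * (of_nat (8 + 7*n) * of_nat (18 + 7*n) * of_nat (19 + 7*n))"
  by (simp add: indicial_def field_simps)

text \<open>The left-hand side is the multiplier of \<open>gamma\<close>. Its linear factors are compared one by one with
  those of the indicial polynomial. This makes the third-order term controllable by the nonlinear part.\<close>

lemma indicial_lower_bound:
  assumes "q \<in> {1/5, 1/6}"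
  shows "real ((16 + 7*n) * (17 + 7*n) * (18 + 7*n)) \<le> norm (indicial q n)"
proof -
  define t where "t = 7 * real n"
  have t: "0 \<le> t" by (simp add: t_def)
  from assms consider "q = 1/5" | "q = 1/6" by auto
  then show ?thesis
  proof cases
    case 1
    have "(16 + t) * (17 + t) * (18 + t) \<le> (22/5 * (6 + t)) * (17 + t) * (18 + t)"
      using t by (intro mult_right_mono) auto
    also have "\<dots> = norm (indicial q n)"
      unfolding 1 indicial_one_fifth norm_mult norm_minus_cancel norm_of_nat by (simp add: t_def)
    finally show ?thesis by (simp add: t_def)
  next
    case 2
    have "(16 + t) * (17 + t) * (18 + t) \<le> (11/3 * (8 + t)) * (19 + t) * (18 + t)"
      using t by (intro mult_right_mono mult_mono) auto
    also have "\<dots> = norm (indicial q n)"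
      unfolding 2 indicial_one_sixth norm_mult norm_minus_cancel norm_of_nat by (simp add: t_def)
    finally show ?thesis by (simp add: t_def)
  qed
qed

lemma indicial_nonzero: "q \<in> {1/5, 1/6} \<Longrightarrow> indicial q n \<noteq> 0"
  using indicial_lower_bound[of q n] by (auto simp del: of_nat_mult of_nat_add)

section \<open>Formal solutions\<close>

lemma normalized_imp_jet_ansatz:
  assumes "fps_nth \<Phi> 0 = 1"
  shows "\<Phi> = jet_ansatz (deriv0 \<Phi>) (fps_shift 2 \<Phi>)"
proof (rule fps_ext)
  fix n
  consider "n = 0" | "n = 1" | m where "n = Suc (Suc m)"
    by (metis One_nat_def not0_implies_Suc)
  then show "fps_nth \<Phi> n = fps_nth (jet_ansatz (deriv0 \<Phi>) (fps_shift 2 \<Phi>)) n"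
    by cases (simp_all add: jet_ansatz_def assms)
qed

lemma jet_ansatz_nth_0 [simp]: "fps_nth (jet_ansatz q v) 0 = 1"
  and jet_ansatz_deriv0 [simp]: "deriv0 (jet_ansatz q v) = q"
  by (simp_all add: jet_ansatz_def)

lemma diffexpr_jet_ansatz_eq_0_iff:
  "diffexpr (jet_ansatz q v) = 0
    \<longleftrightarrow> q \<in> {1/5, 1/6} \<and> linear_part q v + nonlinear_part q v = 0"
proof -
  have "fps_const x + fps_X * g = 0 \<longleftrightarrow> x = 0 \<and> g = 0" for x :: complex and g
  proof
    assume h: "fps_const x + fps_X * g = 0"
    have "x = fps_nth (fps_const x + fps_X * g) 0" by simp
    also have "\<dots> = 0" unfolding h by simp
    finally show "x = 0 \<and> g = 0" using h by simp
  qed simp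
  moreover have "484 * (1 - 5*q) * (1 - 6*q) = 0 \<longleftrightarrow> q \<in> {1/5, 1/6}"
    unfolding mult_eq_0_iff by (auto simp: field_simps)
  ultimately show ?thesis
    unfolding diffexpr_jet_ansatz by simp
qed

text \<open>The equation solved for the coefficient of highest index.\<close>

definition recursion :: "complex \<Rightarrow> complex fps \<Rightarrow> complex fps" where
  "recursion q v = Abs_fps (\<lambda>n. - fps_nth (nonlinear_part q v) n / indicial q n)"

lemma normalized_formal_solution_jet_ansatz_iff:
  "normalized_formal_solution (jet_ansatz q v) \<longleftrightarrow> q \<in> {1/5, 1/6} \<and> recursion q v = v"
proof -
  have "linear_part q v + nonlinear_part q v = 0 \<longleftrightarrow> recursion q v = v"
    if "q \<in> {1/5, 1/6}"
  proof -
    have "indicial q n * x + y = 0 \<longleftrightarrow> - y / indicial q n = x" for n x y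
      unfolding nonzero_divide_eq_eq[OF indicial_nonzero[OF that]] by algebra
    then show ?thesis
      by (simp add: fps_eq_iff fps_nth_linear_part recursion_def)
  qed
  then show ?thesis
    unfolding normalized_formal_solution_def diffexpr_jet_ansatz_eq_0_iff by auto
qed

lemma agree_euler: "agree n f g \<Longrightarrow> agree n (euler k f) (euler k g)"
  by (simp add: agree_def fps_nth_euler)

text \<open>Every occurrence of \<open>v\<close> in the nonlinear part sits under a factor \<open>z\<close>, which
  turns agreement up to \<open>n\<close> into agreement up to \<open>n + 1\<close>.\<close>

lemma recursion_causal:
  assumes "agree n v w"
  shows "agree (Suc n) (recursion q v) (recursion q w)"
proof -
  have a: "agree n (alpha v) (alpha w)"
    unfolding alpha_def by (intro agree_euler assms)
  have b: "agree n (beta v) (beta w)"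
    unfolding beta_def by (intro agree_euler a)
  have c: "agree n (gamma v) (gamma w)"
    unfolding gamma_def by (intro agree_euler b)
  have "agree (Suc n) (nonlinear_part q v) (nonlinear_part q w)"
    unfolding nonlinear_part_def higher_part_def
    by (intro agree_add agree_diff agree_X_mult agree_mult agree_power agree_refl assms a b c)
  then show ?thesis by (simp add: agree_def recursion_def)
qed

lemma formal_solution_unique:
  assumes "normalized_formal_solution \<Phi>" "normalized_formal_solution \<Psi>" "deriv0 \<Phi> = deriv0 \<Psi>"
  shows "\<Phi> = \<Psi>"
proof -
  define q where "q = deriv0 \<Phi>"
  obtain v w where v: "\<Phi> = jet_ansatz q v" and w: "\<Psi> = jet_ansatz q w"
    using normalized_imp_jet_ansatz assms unfolding q_def normalized_formal_solution_def by metis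
  have "recursion q v = v" "recursion q w = w"
    using assms(1,2) unfolding v w normalized_formal_solution_jet_ansatz_iff by auto
  then have "v = w"
    using causal_fixpoint[of "recursion q", OF recursion_causal] by blast
  then show ?thesis by (simp add: v w)
qed

lemma formal_solution_deriv0:
  assumes "normalized_formal_solution \<Phi>"
  shows "deriv0 \<Phi> \<in> {1/5, 1/6}"
  using assms normalized_imp_jet_ansatz[of \<Phi>] normalized_formal_solution_jet_ansatz_iff
  unfolding normalized_formal_solution_def by metis

section \<open>Convergence\<close>

lemma psum_norm_euler_ge: "0 \<le> r \<Longrightarrow> 0 < k \<Longrightarrow> psum_norm r N f \<le> psum_norm r N (euler k f)"
proof (rule psum_norm_mono)
  fix n assume "0 < k"
  then have "1 \<le> real (k + 7 * n)" by simp
  then show "norm (fps_nth f n) \<le> norm (fps_nth (euler k f) n)"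
    unfolding fps_nth_euler norm_mult norm_of_nat
    using mult_right_mono[of 1 "real (k + 7 * n)" "norm (fps_nth f n)"] by simp
qed

text \<open>The bound is the polynomial itself with all signs made positive, evaluated at \<open>U\<close> and
  \<open>z = 1\<close>. It is uniform in \<open>r\<close> and \<open>N\<close>, so \<open>r\<close> may be chosen after \<open>K\<close>.\<close>

lemma higher_part_bounded:
  "\<exists>K\<ge>0. \<forall>r N (u::complex fps) a b. 0 \<le> r \<longrightarrow> r \<le> 1 \<longrightarrow> psum_norm r N u \<le> U \<longrightarrow> psum_norm r N a \<le> U
     \<longrightarrow> psum_norm r N b \<le> U \<longrightarrow> psum_norm r N (higher_part fps_X u a b) \<le> K"
proof -
  define K where "K =
     144*U*U + 144*U^2 + 1584*U + 360*U*U
     + 1 * (48*U*U^2 + 188*U^2 + 1560*U^2 + 24*U^2*U + 12*U^2*U)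
     + 1^2 * (4*U^3*U + 396*U*U^2 + 432*U^3)
     + 1^3 * (24*U^4 + 180*U^2*U^2 + 36*U^4)
     + 1^4 * (4*U^3*U^2 + 24*U*U^4)
     + 1^5 * U^6"
  have K: "psum_norm r N (higher_part fps_X u a b) \<le> K"
    if "0 \<le> r" "r \<le> 1" "psum_norm r N u \<le> U" "psum_norm r N a \<le> U" "psum_norm r N b \<le> U"
    for r N and u a b :: "complex fps"
  proof -
    have X: "psum_norm r N (fps_X :: complex fps) \<le> 1"
      using psum_norm_X_le[OF that(1), of N] that(2) by (rule order_trans)
    show ?thesis
      unfolding higher_part_def K_def
      by (intro psum_norm_add_le psum_norm_diff_le psum_norm_mult_le psum_norm_power_le
          psum_norm_numeral_le X that)
  qed
  show ?thesis
    using K by (intro exI[of _ "max 0 K"]) (simp add: le_max_iff_disj)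
qed

text \<open>Let \<open>s\<^sub>N\<close> be the seminorm of the third-order term \<open>gamma v\<close>; it dominates those of \<open>v\<close>,
  \<open>alpha v\<close> and \<open>beta v\<close>. The recursion gives \<open>s\<^sub>N\<^sub>+\<^sub>1 \<le> 5 r s\<^sub>N\<^sup>2 + K\<close> as long as \<open>r s\<^sub>N \<le> 1\<close>.
  With \<open>M > 2 K\<close> and \<open>r M = 1/10\<close> the bound \<open>s\<^sub>N \<le> M\<close> reproduces itself, since
  \<open>5 r M\<^sup>2 = M / 2\<close>.\<close>

lemma recursion_fixpoint_psum_norm_bounded:
  assumes q: "q \<in> {1/5, 1/6}" and fixpoint: "recursion q v = v"
  shows "\<exists>r>0. \<exists>M. \<forall>N. psum_norm r N v \<le> M"
proof -
  \<comment> \<open>\<open>110 |q| \<le> 22\<close> bounds the constant terms of the arguments, and their \<open>z\<close>-multiples add at most \<open>1\<close>.\<close>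
  obtain K where K: "0 \<le> K" "\<And>r N (u::complex fps) a b.
      0 \<le> r \<Longrightarrow> r \<le> 1 \<Longrightarrow> psum_norm r N u \<le> 23 \<Longrightarrow> psum_norm r N a \<le> 23
      \<Longrightarrow> psum_norm r N b \<le> 23 \<Longrightarrow> psum_norm r N (higher_part fps_X u a b) \<le> K"
    using higher_part_bounded[of 23] by metis
  have "norm q = norm (1/5 :: complex) \<or> norm q = norm (1/6 :: complex)"
    using q by blast
  then have q_le: "norm q \<le> 1/5" unfolding norm_divide by auto
  define M where "M = 2 * K + 1"
  define r where "r = 1 / (10 * M)"
  have M: "1 \<le> M" using K(1) by (simp add: M_def)
  have r: "0 < r" "r \<le> 1" "r * M = 1/10" using M by (simp_all add: r_def field_simps)
  have bound: "psum_norm r N (gamma v) \<le> M" for N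
  proof (induction N)
    case 0
    show ?case using M by simp
  next
    case (Suc N)
    have b: "psum_norm r N (beta v) \<le> M"
      using Suc psum_norm_euler_ge[of r 16 N "beta v"] r by (simp add: gamma_def)
    have a: "psum_norm r N (alpha v) \<le> M"
      using b psum_norm_euler_ge[of r 17 N "alpha v"] r by (simp add: beta_def)
    have v: "psum_norm r N v \<le> M"
      using a psum_norm_euler_ge[of r 18 N v] r by (simp add: alpha_def)
    have shifted: "psum_norm r (Suc N) (fps_const x + fps_X * f) \<le> 23"
      if "psum_norm r N f \<le> M" "norm x \<le> 22" for x and f :: "complex fps"
    proof -
      have "psum_norm r (Suc N) (fps_X * f) \<le> 1"
        using mult_left_mono[OF that(1), of r] r unfolding psum_norm_X_mult by simp
      from psum_norm_add_le[OF _ psum_norm_const_le this, of x] r(1) that(2)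
      show ?thesis by simp
    qed
    have "psum_norm r N (3 * beta v ^ 2 - 2 * alpha v * gamma v) \<le> 3 * M ^ 2 + 2 * M * M"
      using r(1) by (intro psum_norm_diff_le psum_norm_mult_le psum_norm_power_le
          psum_norm_numeral_le a b Suc) auto
    then have "psum_norm r (Suc N) (fps_X * (3 * beta v ^ 2 - 2 * alpha v * gamma v))
        \<le> r * (3 * M ^ 2 + 2 * M * M)"
      unfolding psum_norm_X_mult using r(1) by simp
    also have "\<dots> = 5 * (r * M) * M" by (simp add: algebra_simps power2_eq_square)
    also have "\<dots> = M / 2" using r(3) by simp
    finally have quadratic: "psum_norm r (Suc N)
        (fps_X * (3 * beta v ^ 2 - 2 * alpha v * gamma v)) \<le> M / 2" .
    have "norm (fps_nth (gamma v) n) \<le> norm (fps_nth (nonlinear_part q v) n)" for n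
    proof -
      have "norm (fps_nth (gamma v) n) = real ((16 + 7*n) * (17 + 7*n) * (18 + 7*n)) * norm (fps_nth v n)"
        unfolding fps_nth_gamma norm_mult norm_of_nat by simp
      also have "\<dots> \<le> norm (indicial q n) * norm (fps_nth v n)"
        by (intro mult_right_mono indicial_lower_bound q) simp
      also have "indicial q n * fps_nth v n = - fps_nth (nonlinear_part q v) n"
        using indicial_nonzero[OF q, of n] by (subst fixpoint[symmetric]) (simp add: recursion_def)
      then have "norm (indicial q n) * norm (fps_nth v n) = norm (fps_nth (nonlinear_part q v) n)"
        by (metis norm_minus_cancel norm_mult)
      finally show ?thesis .
    qed
    then have "psum_norm r (Suc N) (gamma v) \<le> psum_norm r (Suc N) (nonlinear_part q v)"
      using r(1) by (intro psum_norm_mono) auto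
    also have "\<dots> \<le> M / 2 + K"
      unfolding nonlinear_part_def using r
      by (intro psum_norm_add_le K(2) quadratic shifted a b v) (use q_le in \<open>auto simp: norm_mult\<close>)
    also have "\<dots> \<le> M" by (simp add: M_def)
    finally show ?case .
  qed
  have "psum_norm r N v \<le> M" for N
    using bound[of N] psum_norm_euler_ge[of r 16 N "beta v"] psum_norm_euler_ge[of r 17 N "alpha v"]
      psum_norm_euler_ge[of r 18 N v] r(1) by (simp add: alpha_def beta_def gamma_def)
  with r(1) show ?thesis by blast
qed

lemma fps_conv_radius_jet_ansatz: "fps_conv_radius v \<le> fps_conv_radius (jet_ansatz q v)"
proof -
  have X: "fps_conv_radius v \<le> fps_conv_radius (fps_X * f)"
    if "fps_conv_radius v \<le> fps_conv_radius f" for f :: "complex fps"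
    using fps_conv_radius_mult[of "fps_X :: complex fps" f] that by (simp add: min_def split: if_splits)
  have add: "fps_conv_radius v \<le> fps_conv_radius (fps_const x + f)"
    if "fps_conv_radius v \<le> fps_conv_radius f" for f and x :: complex
    using fps_conv_radius_add[of "fps_const x" f] that by (simp add: min_def split: if_splits)
  show ?thesis
    unfolding jet_ansatz_def fps_const_1_eq_1[symmetric] by (intro X add) simp
qed

lemma solution_germ_exists:
  assumes "q \<in> {1/5, 1/6}"
  shows "\<exists>\<Phi>. normalized_solution_germ \<Phi> \<and> deriv0 \<Phi> = q"
proof -
  obtain v where v: "recursion q v = v"
    using causal_fixpoint[of "recursion q", OF recursion_causal] by blast
  obtain r M where "0 < r" "\<And>N. psum_norm r N v \<le> M"
    using recursion_fixpoint_psum_norm_bounded[OF assms v] by blast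
  then have "ereal r \<le> fps_conv_radius v"
    by (rule fps_conv_radius_ge_if_psum_norm_bounded)
  then have "0 < fps_conv_radius (jet_ansatz q v)"
    using \<open>0 < r\<close> fps_conv_radius_jet_ansatz[of v q]
    by (meson ereal_less(2) less_le_trans)
  moreover have "normalized_formal_solution (jet_ansatz q v)"
    unfolding normalized_formal_solution_jet_ansatz_iff using assms v by blast
  ultimately have "normalized_solution_germ (jet_ansatz q v)"
    by (simp add: normalized_solution_germ_def)
  then show ?thesis using jet_ansatz_deriv0 by blast
qed

theorem theorem7p1:
  shows "(\<exists>\<Phi>1 \<Phi>2. \<Phi>1 \<noteq> \<Phi>2
            \<and> {\<Phi>. normalized_solution_germ \<Phi>} = {\<Phi>1, \<Phi>2}
            \<and> deriv0 \<Phi>1 = 1 / 5 \<and> deriv0 \<Phi>2 = 1 / 6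
            \<and> (\<forall>\<Phi>. normalized_solution_germ \<Phi> \<longrightarrow>
                  (\<Phi> = \<Phi>1 \<longleftrightarrow> deriv0 \<Phi> = 1 / 5) \<and> (\<Phi> = \<Phi>2 \<longleftrightarrow> deriv0 \<Phi> = 1 / 6)))
       \<and> (\<forall>\<Phi> \<Psi>. \<forall>c \<in> {1 / 5, 1 / 6}.
            normalized_formal_solution \<Phi> \<and> normalized_formal_solution \<Psi>
              \<and> deriv0 \<Phi> = c \<and> deriv0 \<Psi> = c
            \<longrightarrow> (\<forall>n\<ge>2. fps_nth \<Phi> n = fps_nth \<Psi> n))"
proof (rule conjI)
  obtain \<Phi>1 where 1: "normalized_solution_germ \<Phi>1" "deriv0 \<Phi>1 = 1/5"
    using solution_germ_exists[of "1/5"] by blast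
  obtain \<Phi>2 where 2: "normalized_solution_germ \<Phi>2" "deriv0 \<Phi>2 = 1/6"
    using solution_germ_exists[of "1/6"] by blast
  have unique: "\<Phi> = \<Psi> \<longleftrightarrow> deriv0 \<Phi> = deriv0 \<Psi>"
    if "normalized_solution_germ \<Phi>" "normalized_solution_germ \<Psi>" for \<Phi> \<Psi>
    using that formal_solution_unique[of \<Phi> \<Psi>] unfolding normalized_solution_germ_def by blast
  have char1: "\<Phi> = \<Phi>1 \<longleftrightarrow> deriv0 \<Phi> = 1/5" and char2: "\<Phi> = \<Phi>2 \<longleftrightarrow> deriv0 \<Phi> = 1/6"
    if "normalized_solution_germ \<Phi>" for \<Phi>
    using unique[OF that 1(1)] unique[OF that 2(1)] 1(2) 2(2) by (simp_all only:)
  have "\<Phi> = \<Phi>1 \<or> \<Phi> = \<Phi>2" if "normalized_solution_germ \<Phi>" for \<Phi>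
    using formal_solution_deriv0[of \<Phi>] that char1[OF that] char2[OF that]
    unfolding normalized_solution_germ_def by blast
  then have "{\<Phi>. normalized_solution_germ \<Phi>} = {\<Phi>1, \<Phi>2}"
    using 1(1) 2(1) by blast
  moreover have "\<Phi>1 \<noteq> \<Phi>2" unfolding char2[OF 1(1)] 1(2) by simp
  ultimately show "\<exists>\<Phi>1 \<Phi>2. \<Phi>1 \<noteq> \<Phi>2
            \<and> {\<Phi>. normalized_solution_germ \<Phi>} = {\<Phi>1, \<Phi>2}
            \<and> deriv0 \<Phi>1 = 1 / 5 \<and> deriv0 \<Phi>2 = 1 / 6
            \<and> (\<forall>\<Phi>. normalized_solution_germ \<Phi> \<longrightarrow>
                  (\<Phi> = \<Phi>1 \<longleftrightarrow> deriv0 \<Phi> = 1 / 5) \<and> (\<Phi> = \<Phi>2 \<longleftrightarrow> deriv0 \<Phi> = 1 / 6))"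
    using 1(2) 2(2) char1 char2 by blast
next
  show "\<forall>\<Phi> \<Psi>. \<forall>c \<in> {1 / 5, 1 / 6}.
            normalized_formal_solution \<Phi> \<and> normalized_formal_solution \<Psi>
              \<and> deriv0 \<Phi> = c \<and> deriv0 \<Psi> = c
            \<longrightarrow> (\<forall>n\<ge>2. fps_nth \<Phi> n = fps_nth \<Psi> n)"
    using formal_solution_unique by metis
qed

end
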